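(* Let $T:\mathbb{C}^n\to\mathbb{C}^n$ be $\mathbb{C}$-linear, and let $E$ be a measurable subset of a real $n$-dimensional subspace $V\subset(\mathbb{C}^n)_{\mathbb{R}}$. Then $$\rho_{T(V)}\cdot\mathcal{V}_n(T(E))=|\det T|\cdot\rho_V\cdot\mathcal{V}_n(E).$$
   Context: $(\mathbb{C}^n)_{\mathbb{R}}=\mathbb{R}^{2n}$ is the underlying real space of $\mathbb{C}^n$, with inner product $\langle\cdot,\cdot\rangle_{\mathbb{R}}=\operatorname{Re}\langle\cdot,\cdot\rangle$, where $\langle\cdot,\cdot\rangle$ is the canonical Hermitian product of $\mathbb{C}^n$. $\mathcal{V}_n$ denotes the real $n$-dimensional volume in $(\mathbb{C}^n)_{\mathbb{R}}$ (on a real $n$-dimensional subspace, Lebesgue measure for the induced Euclidean structure; sets contained in real subspaces of smaller dimension have $\mathcal{V}_n=0$). The convention $0\cdot\infty=0$ is used. $\det T$ is the complex determinant. Holomorphy index: for a real subspace $V\subset(\mathbb{C}^n)_{\mathbb{R}}$ of real dimension $d$, let $\mathrm{i}V=\{\mathrm{i}v:v\in V\}$ and let $0\le\theta_1\le\cdots\le\theta_d\le\frac\pi2$ be the principal angles of $V$ and $\mathrm{i}V$ in $(\mathbb{C}^n)_{\mathbb{R}}$, i.e. the angles for which there are $\langle\cdot,\cdot\rangle_{\mathbb{R}}$-orthonormal bases $(a_1,\ldots,a_d)$ of $V$ and $(b_1,\ldots,b_d)$ of $\mathrm{i}V$ with $\langle a_j,b_k\rangle_{\mathbb{R}}=0$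 for $j\neq k$ and $\langle a_j,b_j\rangle_{\mathbb{R}}=\cos\theta_j$. (It is known that $\theta_{2j-1}=\theta_{2j}$ for $1\le j\le\lfloor d/2\rfloor$, and $\theta_d=\frac\pi2$ if $d$ is odd.) The Kähler angles of $V$ are $\mu_j=\theta_{2j-1}$ for $1\le j\le h=\lceil d/2\rceil$, and the holomorphy index of $V$ is $\rho_V=\prod_{j=1}^h\sin\mu_j$ (an empty product is $1$). *)

theory Defs
  imports "HOL-Analysis.Analysis"
begin

text \<open>
  The space \<open>\<complex>\<^sup>n\<close> is \<^typ>\<open>complex ^ 'n\<close> with \<open>n = CARD('n)\<close>. The library constants \<^const>\<open>inner\<close>,
  \<^const>\<open>norm\<close>, \<^const>\<open>subspace\<close>, \<^const>\<open>span\<close> and \<^const>\<open>dim\<close> on this type are those of the underlying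
  real Euclidean space; \<open>inner\<close> is the real part of the canonical Hermitian product:
\<close>

lemma inner_eq_Re_hermitian:
  fixes x y :: "complex ^ 'n"
  shows "x \<bullet> y = Re (\<Sum>i\<in>UNIV. x $ i * cnj (y $ i))"
  by (simp add: inner_vec_def inner_complex_def)

definition is_ortho_basis :: "'a::euclidean_space set \<Rightarrow> (nat \<Rightarrow> 'a) \<Rightarrow> bool" where
  "is_ortho_basis V a \<longleftrightarrow>
     (\<forall>j<dim V. \<forall>k<dim V. a j \<bullet> a k = (if j = k then 1 else 0)) \<and> span (a ` {..<dim V}) = V"

definition is_principal_angles :: "'a::euclidean_space set \<Rightarrow> 'a set \<Rightarrow> real list \<Rightarrow> bool" where
  "is_principal_angles V W \<theta> \<longleftrightarrow>
     length \<theta> = dim V \<and> sorted \<theta> \<and> set \<theta> \<subseteq> {0..pi / 2} \<and>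
     (\<exists>a b. is_ortho_basis V a \<and> is_ortho_basis W b \<and>
        (\<forall>j<dim V. \<forall>k<dim V. a j \<bullet> b k = (if j = k then cos (\<theta> ! j) else 0)))"

text \<open>
  For subspaces \<open>V\<close>, \<open>W\<close> of equal dimension the list is uniquely determined (the cosines are the
  singular values of the orthogonal projection from \<open>V\<close> to \<open>W\<close>).
\<close>

definition principal_angles :: "'a::euclidean_space set \<Rightarrow> 'a set \<Rightarrow> real list" where
  "principal_angles V W = (SOME \<theta>. is_principal_angles V W \<theta>)"

definition i_times :: "(complex ^ 'n) set \<Rightarrow> (complex ^ 'n) set" where
  "i_times V = (\<lambda>v. \<i> *s v) ` V"

text \<open>
  Lists are indexed from \<open>0\<close>, so \<open>\<theta>\<^bsub>2j-1\<^esub>\<close> is entry \<open>2 * (j - 1)\<close>; \<open>(dim V + 1) div 2\<close> is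
  \<open>\<lceil>dim V / 2\<rceil>\<close>.
\<close>

definition kaehler_angle :: "(complex ^ 'n::finite) set \<Rightarrow> nat \<Rightarrow> real" where
  "kaehler_angle V j = principal_angles V (i_times V) ! (2 * (j - 1))"

definition holomorphy_index :: "(complex ^ 'n::finite) set \<Rightarrow> real" where
  "holomorphy_index V = (\<Prod>j = 1..(dim V + 1) div 2. sin (kaehler_angle V j))"

text \<open>
  Lebesgue measure (on the Lebesgue \<open>\<sigma>\<close>-algebra) of a real \<open>n\<close>-dimensional subspace \<open>V\<close>, transported
  from \<open>\<real>\<^sup>n\<close> along a linear isometry onto \<open>V\<close>. It does not depend on the isometry, since Lebesgue
  measure on \<open>\<real>\<^sup>n\<close> is invariant under orthogonal maps.
\<close>

definition subspace_lebesgue :: "(complex ^ 'n::finite) set \<Rightarrow> (complex ^ 'n) measure" where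
  "subspace_lebesgue V =
     embed_measure lebesgue
       (SOME f :: real ^ 'n \<Rightarrow> complex ^ 'n. linear f \<and> (\<forall>x. norm (f x) = norm x) \<and> range f = V)"

text \<open>
  The real \<open>n\<close>-dimensional volume of a set contained in some real subspace of dimension at most
  \<open>n\<close>. If \<open>dim A = n\<close>, then \<open>span A\<close> is the only \<open>n\<close>-dimensional subspace containing \<open>A\<close>. The value
  carries no meaning if \<open>dim A > n\<close>.
\<close>

definition n_volume :: "(complex ^ 'n::finite) set \<Rightarrow> ennreal" where
  "n_volume A = (if dim A < CARD('n) then 0 else emeasure (subspace_lebesgue (span A)) A)"

end

theory Submission
  imports Defs
begin

text \<open>
  Let \<open>f\<close> be a real linear isometry of \<open>\<real>\<^sup>n\<close> onto \<open>V\<close> and let \<open>M\<close> be the complex matrix with columns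
  \<open>f e\<^sub>1, \<dots>, f e\<^sub>n\<close>. The key fact is that the holomorphy index of \<open>V\<close> equals \<open>\<bar>det M\<bar>\<close>
  (\<open>holomorphy_index_eq_det\<close>). Once this is known, let \<open>g\<close> be such an isometry onto \<open>T V\<close> and write
  \<open>T \<circ> f = g \<circ> L\<close> with \<open>L\<close> linear on \<open>\<real>\<^sup>n\<close>. Comparing frame matrices, \<open>det T\<close> times the
  determinant for \<open>V\<close> is the determinant for \<open>T V\<close> times the real number \<open>det L\<close>, and \<open>\<bar>det L\<bar>\<close>
  is the factor by which \<open>T\<close> changes \<open>n\<close>-dimensional volume on \<open>V\<close> (\<open>emeasure_linear_image\<close>). The
  absolute values give the formula. If \<open>T V\<close> has dimension below \<open>n\<close>, then \<open>T\<close> is singular and both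
  sides vanish.

  For the key fact, the Hermitian Gram matrix of the frame is \<open>I - \<i> B\<close> with \<open>B\<close> real and skew, which
  gives \<open>\<bar>det M\<bar>\<^sup>4 = det (I - B B\<^sup>T)\<close> (\<open>cmod_det_frame_matrix_power4\<close>). The entries of \<open>B\<close> are inner
  products of basis vectors of \<open>V\<close> and of \<open>\<i>V\<close>, so the eigenvalues of \<open>B B\<^sup>T\<close> are the squared cosines
  of the principal angles and \<open>\<bar>det M\<bar>\<^sup>2\<close> is the product of the sines of all of them. Skew symmetry
  makes every nonzero eigenvalue have even multiplicity (\<open>skew_symmetric_even_multiplicity\<close>), so this
  product is the square of the product over every second angle. That the principal angles used in the
  definition exist at all is a singular value decomposition (\<open>principal_angles_exist\<close>).
\<close>

section \<open>Volume of linear images\<close>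

lemma shear_linear:
  fixes m n :: "'n::finite"
  shows "linear (\<lambda>x::real^'n. \<chi> i. if i = m then x $ m + x $ n else x $ i)"
  by (rule linearI) (auto simp: algebra_simps vec_eq_iff)

text \<open>
  The matrix of a shear arises from the identity by adding one row to another.
\<close>

lemma det_shear:
  fixes m n :: "'n::finite"
  assumes "m \<noteq> n"
  shows "det (matrix (\<lambda>x::real^'n. \<chi> i. if i = m then x $ m + x $ n else x $ i)) = 1"
proof -
  have "matrix (\<lambda>x::real^'n. \<chi> i. if i = m then x $ m + x $ n else x $ i)
      = (\<chi> k. if k = m then row m (mat 1) + 1 *s row n (mat 1) else row k (mat 1))"
    by (auto simp: matrix_def row_def mat_def axis_def vec_eq_iff)
  then show ?thesis
    using det_row_operation[OF assms, of "mat 1" 1] by simp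
qed

text \<open>
  A box whose lower corner has a nonnegative \<open>n\<close>-th coordinate keeps its volume under the shear by a
  cut-and-shift argument. Any other box is first moved to such a position: by linearity, translating
  the argument only translates the image.
\<close>

lemma measure_shear_box:
  fixes m n :: "'n::finite" and a b :: "real^'n"
  assumes "m \<noteq> n"
  shows "measure lebesgue ((\<lambda>x. \<chi> i. if i = m then x $ m + x $ n else x $ i) ` cbox a b)
       = measure lebesgue (cbox a b)" (is "measure _ (?h ` _) = _")
proof (cases "cbox a b = {}")
  case False
  interpret h: linear ?h by (rule shear_linear)
  \<comment> \<open>The translation that moves the lower corner of the box to the hyperplane \<open>x\<^sub>n = 0\<close>.\<close>
  define v where "v = - axis n (a $ n)"
  have box: "(+) v ` cbox a b = cbox (v + a) (v + b)"
    by (simp add: cbox_translation)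
  have "?h ` cbox a b = (+) (- ?h v) ` ?h ` (+) v ` cbox a b"
    by (simp add: image_image h.add)
  then have "measure lebesgue (?h ` cbox a b) = measure lebesgue (?h ` cbox (v + a) (v + b))"
    by (simp only: measure_translation box)
  also have "\<dots> = measure lebesgue (cbox (v + a) (v + b))"
  proof (rule measure_shear_interval[OF assms])
    show "cbox (v + a) (v + b) \<noteq> {}"
      unfolding box[symmetric] using False by simp
    show "0 \<le> (v + a) $ n"
      by (simp add: v_def)
  qed
  also have "\<dots> = measure lebesgue (cbox a b)"
    unfolding box[symmetric] by (rule measure_translation)
  finally show ?thesis .
qed simp

lemma measure_coordinate_swap_box:
  fixes m n :: "'n::finite" and a b :: "real^'n"
  shows "measure lebesgue ((\<lambda>x. \<chi> i. x $ Transposition.transpose m n i) ` cbox a b)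
       = measure lebesgue (cbox a b)" (is "measure _ (?h ` _) = _")
proof (cases "cbox a b = {}")
  case False
  have eq: "?h ` cbox a b = cbox (?h a) (?h b)"
    by (auto simp: image_iff lambda_swap_Galois mem_box_cart) (metis transpose_involutory)+
  with False have "cbox (?h a) (?h b) \<noteq> {}"
    by blast
  then show ?thesis
    using prod.permute[OF permutes_swap_id, where S=UNIV and g="\<lambda>i. (b - a) $ i", symmetric]
    by (simp add: eq content_cbox_cart False)
qed simp

lemma orthogonal_coordinate_swap:
  fixes m n :: "'n::finite"
  shows "orthogonal_transformation (\<lambda>x::real^'n. \<chi> i. x $ Transposition.transpose m n i)"
proof -
  have "linear (\<lambda>x::real^'n. \<chi> i. x $ Transposition.transpose m n i)"
    by (rule linearI) (simp_all add: vec_eq_iff)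
  moreover have "(\<Sum>i\<in>UNIV. (x $ Transposition.transpose m n i)\<^sup>2) = (\<Sum>i\<in>UNIV. (x $ i)\<^sup>2)" for x :: "real^'n"
    using sum.permute[OF permutes_swap_id, where S=UNIV and g="\<lambda>i. (x $ i)\<^sup>2", of m n]
    by (simp add: o_def)
  ultimately show ?thesis
    by (simp add: orthogonal_transformation norm_vec_def L2_set_def)
qed

text \<open>
  Both sides are multiplicative under composition of maps, and every linear map is a product of
  singular maps with a vanishing coordinate, coordinate scalings, coordinate swaps and shears.
\<close>

lemma lmeasurable_linear_image_det:
  fixes f :: "real^'n::finite \<Rightarrow> real^'n"
  assumes "linear f" "S \<in> lmeasurable"
  shows "f ` S \<in> lmeasurable \<and> measure lebesgue (f ` S) = \<bar>det (matrix f)\<bar> * measure lebesgue S"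
proof -
  let ?P = "\<lambda>f::real^'n \<Rightarrow> real^'n. \<forall>S\<in>lmeasurable. f ` S \<in> lmeasurable \<and>
              measure lebesgue (f ` S) = \<bar>det (matrix f)\<bar> * measure lebesgue S"
  have "?P f"
  proof (rule induct_linear_elementary[OF \<open>linear f\<close>])
    fix f g :: "real^'n \<Rightarrow> real^'n"
    assume "linear f" "linear g" "?P f" "?P g"
    then show "?P (f \<circ> g)"
      by (simp add: matrix_compose det_mul abs_mult image_comp[symmetric] del: o_apply image_comp)
  next
    fix f :: "real^'n \<Rightarrow> real^'n" and i
    assume f: "linear f" and "\<And>x. f x $ i = 0"
    then have "\<not> surj f"
      by (metis one_neq_zero surjE vec_component)
    then have "\<not> inj f"
      using f linear_injective_imp_surjective by blast
    moreover from this have "det (matrix f) = 0"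
      using det_nz_iff_inj[OF f] by blast
    ultimately show "?P f"
      using negligible_linear_singular_image[OF f] negligible_iff_measure by auto
  next
    fix c :: "'n \<Rightarrow> real"
    have "matrix (\<lambda>x::real^'n. \<chi> i. c i * x $ i) = (\<chi> i j. if i = j then c i else 0)"
      by (auto simp: matrix_def axis_def vec_eq_iff)
    then have "det (matrix (\<lambda>x::real^'n. \<chi> i. c i * x $ i)) = prod c UNIV"
      by (simp add: det_diagonal)
    then show "?P (\<lambda>x. \<chi> i. c i * x $ i)"
      by (simp add: measurable_stretch measure_stretch)
  next
    fix m n :: 'n
    let ?h = "\<lambda>x::real^'n. \<chi> i. x $ Transposition.transpose m n i"
    have h: "linear ?h" "\<bar>det (matrix ?h)\<bar> = 1"
      using orthogonal_coordinate_swap orthogonal_transformation_linear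
        orthogonal_transformation_det by blast+
    show "?P ?h"
    proof
      fix S :: "(real^'n) set"
      assume "S \<in> lmeasurable"
      then have "?h ` S \<in> lmeasurable \<and> 1 * measure lebesgue S = measure lebesgue (?h ` S)"
        by (rule measure_linear_sufficient[OF h(1)]) (simp only: measure_coordinate_swap_box mult_1)
      then show "?h ` S \<in> lmeasurable \<and>
          measure lebesgue (?h ` S) = \<bar>det (matrix ?h)\<bar> * measure lebesgue S"
        by (simp only: h(2))
    qed
  next
    fix m n :: 'n
    assume "m \<noteq> n"
    let ?h = "\<lambda>x::real^'n. \<chi> i. if i = m then x $ m + x $ n else x $ i"
    show "?P ?h"
    proof
      fix S :: "(real^'n) set"
      assume "S \<in> lmeasurable"
      then have "?h ` S \<in> lmeasurable \<and> 1 * measure lebesgue S = measure lebesgue (?h ` S)"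
        by (rule measure_linear_sufficient[OF shear_linear])
           (simp only: measure_shear_box[OF \<open>m \<noteq> n\<close>] mult_1)
      then show "?h ` S \<in> lmeasurable \<and>
          measure lebesgue (?h ` S) = \<bar>det (matrix ?h)\<bar> * measure lebesgue S"
        by (simp only: det_shear[OF \<open>m \<noteq> n\<close>] abs_one)
    qed
  qed
  then show ?thesis
    using assms(2) by blast
qed

text \<open>
  An injective linear map also matches the sets of infinite measure, because its inverse is linear and
  so preserves finiteness of measure.
\<close>

lemma emeasure_linear_image:
  fixes f :: "real^'n::finite \<Rightarrow> real^'n"
  assumes f: "linear f" and inj: "inj f" and S: "S \<in> sets lebesgue"
  shows "f ` S \<in> sets lebesgue"
    and "emeasure lebesgue (f ` S) = ennreal \<bar>det (matrix f)\<bar> * emeasure lebesgue S"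
proof -
  show fS: "f ` S \<in> sets lebesgue"
    by (rule differentiable_image_in_sets_lebesgue[OF S])
       (simp_all add: f linear_imp_differentiable_on)
  have det: "det (matrix f) \<noteq> 0"
    using det_nz_iff_inj[OF f] inj by blast
  show "emeasure lebesgue (f ` S) = ennreal \<bar>det (matrix f)\<bar> * emeasure lebesgue S"
  proof (cases "S \<in> lmeasurable")
    case True
    then show ?thesis
      using lmeasurable_linear_image_det[OF f True]
      by (simp add: emeasure_eq_measure2 fmeasurableD2 ennreal_mult)
  next
    case False
    obtain g where g: "linear g" "g \<circ> f = id"
      using linear_injective_left_inverse[OF f inj] by blast
    have "f ` S \<notin> lmeasurable"
    proof
      assume "f ` S \<in> lmeasurable"
      then have "g ` f ` S \<in> lmeasurable"
        using lmeasurable_linear_image_det[OF g(1)] by blast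
      then show False
        using False g(2) by (simp add: image_comp)
    qed
    then have "emeasure lebesgue (f ` S) = \<infinity>" "emeasure lebesgue S = \<infinity>"
      using False S fS by (auto simp: fmeasurable_def simp del: emeasure_completion dest!: leI simp flip: top_unique)
    then show ?thesis
      using det by (simp add: ennreal_mult_top)
  qed
qed

section \<open>Existence of principal angles\<close>

lemma norm_preserving_inner:
  fixes f :: "'a::real_inner \<Rightarrow> 'b::real_inner"
  assumes "linear f" "\<And>x. norm (f x) = norm x"
  shows "f x \<bullet> f y = x \<bullet> y"
proof -
  have "norm (f x + f y) = norm (x + y)"
    using assms by (simp flip: linear_add)
  then show ?thesis
    by (simp add: dot_norm assms(2))
qed

text \<open>
  The inner product attains its maximum on the product of the two compact unit spheres. The maximum is
  not negative, since replacing \<open>a\<close> by \<open>- a\<close> changes its sign.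
\<close>

lemma maximal_inner_pair:
  fixes V W :: "'a::euclidean_space set"
  assumes V: "subspace V" "dim V \<noteq> 0" and W: "subspace W" "dim W \<noteq> 0"
  obtains a b where "a \<in> V" "b \<in> W" "norm a = 1" "norm b = 1" "0 \<le> a \<bullet> b"
    "\<And>v w. v \<in> V \<Longrightarrow> w \<in> W \<Longrightarrow> v \<bullet> w \<le> (a \<bullet> b) * norm v * norm w"
proof -
  have unit: "\<exists>u. u \<in> U \<inter> sphere 0 1" if U: "subspace U" "dim U \<noteq> 0" for U :: "'a set"
  proof -
    have "\<not> U \<subseteq> {0}"
      using U(2) by simp
    then obtain u where "u \<in> U" "u \<noteq> 0"
      by auto
    then have "u /\<^sub>R norm u \<in> U \<inter> sphere 0 1"
      using U(1) by (simp add: subspace_scale)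
    then show ?thesis ..
  qed
  let ?S = "(V \<inter> sphere 0 1) \<times> (W \<inter> sphere 0 1)"
  have "compact ?S"
    by (intro compact_Times closed_Int_compact closed_subspace V W compact_sphere)
  moreover have "?S \<noteq> {}"
    using unit[OF V] unit[OF W] by blast
  moreover have "continuous_on ?S (\<lambda>q. fst q \<bullet> snd q)"
    by (intro continuous_intros)
  ultimately have "\<exists>p\<in>?S. \<forall>q\<in>?S. fst q \<bullet> snd q \<le> fst p \<bullet> snd p"
    by (rule continuous_attains_sup)
  then obtain p where p: "p \<in> ?S" "\<And>q. q \<in> ?S \<Longrightarrow> fst q \<bullet> snd q \<le> fst p \<bullet> snd p"
    by blast
  obtain a b where [simp]: "p = (a, b)" by fastforce
  have ab: "a \<in> V" "b \<in> W" "norm a = 1" "norm b = 1"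
    using p(1) by auto
  have max: "v \<bullet> w \<le> a \<bullet> b" if "v \<in> V" "w \<in> W" "norm v = 1" "norm w = 1" for v w
    using p(2)[of "(v, w)"] that by simp
  have "(- a) \<bullet> b \<le> a \<bullet> b"
    by (rule max) (use ab V(1) in \<open>auto simp: subspace_neg\<close>)
  then have nonneg: "0 \<le> a \<bullet> b" by simp
  have "v \<bullet> w \<le> (a \<bullet> b) * norm v * norm w" if "v \<in> V" "w \<in> W" for v w
  proof (cases "v = 0 \<or> w = 0")
    case False
    have "(v /\<^sub>R norm v) \<bullet> (w /\<^sub>R norm w) \<le> a \<bullet> b"
      by (rule max) (use that V(1) W(1) False in \<open>auto simp: subspace_scale\<close>)
    then show ?thesis
      using False by (simp add: field_simps)
  qed auto
  with ab nonneg show ?thesis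
    using that by blast
qed

text \<open>
  The first-order condition at the maximum, without derivatives: if \<open>u\<close> is the normalized \<open>v\<close> and
  \<open>s = u \<bullet> b\<close>, the component of \<open>b\<close> in the plane of \<open>a\<close> and \<open>u\<close> is \<open>w = (a \<bullet> b) a + s u\<close>, and maximality
  applied to \<open>w\<close> bounds its norm by \<open>a \<bullet> b\<close>. As \<open>\<parallel>w\<parallel>\<^sup>2 = (a \<bullet> b)\<^sup>2 + s\<^sup>2\<close>, this forces \<open>s = 0\<close>.
\<close>

lemma maximal_inner_orthogonal:
  fixes a b :: "'a::real_inner"
  assumes V: "subspace V" "a \<in> V" "norm a = 1" and m: "0 \<le> a \<bullet> b"
    and max: "\<And>v. v \<in> V \<Longrightarrow> v \<bullet> b \<le> (a \<bullet> b) * norm v"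
    and v: "v \<in> V" "v \<bullet> a = 0"
  shows "v \<bullet> b = 0"
proof (cases "v = 0")
  case False
  define u where "u = v /\<^sub>R norm v"
  define s where "s = u \<bullet> b"
  define w where "w = (a \<bullet> b) *\<^sub>R a + s *\<^sub>R u"
  have u: "u \<in> V" "u \<bullet> u = 1" "u \<bullet> a = 0"
    using v V(1) False by (auto simp: u_def subspace_scale dot_square_norm power2_eq_square)
  have aa: "a \<bullet> a = 1"
    using V(3) by (simp add: dot_square_norm)
  have "w \<bullet> w = (a \<bullet> b)\<^sup>2 + s\<^sup>2"
    using u aa by (simp add: w_def inner_add_left inner_add_right inner_commute[of a u] power2_eq_square)
  then have nw: "norm w ^ 2 = (a \<bullet> b)\<^sup>2 + s\<^sup>2"
    by (simp add: dot_square_norm)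
  have "w \<bullet> b = (a \<bullet> b)\<^sup>2 + s\<^sup>2"
    by (simp add: w_def inner_add_left s_def power2_eq_square)
  moreover have "w \<bullet> b \<le> (a \<bullet> b) * norm w"
    using u V by (intro max) (simp add: w_def subspace_add subspace_scale)
  ultimately have "norm w ^ 2 \<le> (a \<bullet> b) * norm w"
    by (simp add: nw)
  then have "norm w \<le> a \<bullet> b"
    using m by (cases "norm w = 0") (simp_all add: power2_eq_square)
  then have "norm w ^ 2 \<le> (a \<bullet> b)\<^sup>2"
    by (simp add: power_mono)
  then have "s = 0"
    by (simp add: nw)
  then show ?thesis
    using False by (simp add: s_def u_def)
qed simp

lemma dim_orthogonal_complement_of_unit:
  fixes a :: "'a::euclidean_space"
  assumes "subspace V" "a \<in> V" "a \<noteq> 0"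
  shows "dim {v \<in> V. v \<bullet> a = 0} + 1 = dim V"
proof -
  have "dim {y \<in> V. \<forall>x\<in>span {a}. orthogonal x y} + dim (span {a}) = dim V"
    by (rule dim_subspace_orthogonal_to_vectors) (use assms in \<open>auto simp: span_minimal\<close>)
  moreover have "{y \<in> V. \<forall>x\<in>span {a}. orthogonal x y} = {v \<in> V. v \<bullet> a = 0}"
    by (auto simp: span_singleton orthogonal_def inner_commute)
  ultimately show ?thesis
    using assms by simp
qed

lemma is_ortho_basis_in:
  assumes "is_ortho_basis V b" "j < dim V"
  shows "b j \<in> V"
proof -
  have "b j \<in> span (b ` {..<dim V})"
    using assms(2) by (intro span_base) simp
  also have "\<dots> = V"
    using assms(1) unfolding is_ortho_basis_def by blast
  finally show ?thesis .
qed

lemma is_ortho_basis_norm: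
  assumes "is_ortho_basis V b" "j < dim V"
  shows "norm (b j) = 1"
  using assms by (simp add: is_ortho_basis_def norm_eq_sqrt_inner)

lemma is_ortho_basis_Cons:
  fixes a :: "'a::euclidean_space"
  assumes V: "subspace V" "a \<in> V" "norm a = 1"
    and b: "is_ortho_basis {v \<in> V. v \<bullet> a = 0} b"
  shows "is_ortho_basis V (case_nat a b)"
proof -
  let ?V' = "{v \<in> V. v \<bullet> a = 0}"
  have d: "dim V = Suc (dim ?V')"
    using dim_orthogonal_complement_of_unit[of V a] V by force
  have aa: "a \<bullet> a = 1"
    using V(3) by (simp add: dot_square_norm)
  have bV: "b j \<in> ?V'" if "j < dim ?V'" for j
    using is_ortho_basis_in[OF b that] .
  have img: "case_nat a b ` {..<dim V} = insert a (b ` {..<dim ?V'})"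
    unfolding d lessThan_Suc_eq_insert_0 by (simp add: image_image)
  have "span (insert a (b ` {..<dim ?V'})) = V"
  proof
    show "span (insert a (b ` {..<dim ?V'})) \<subseteq> V"
      using V bV by (intro span_minimal) auto
    show "V \<subseteq> span (insert a (b ` {..<dim ?V'}))"
    proof
      fix v assume "v \<in> V"
      then have "v - (v \<bullet> a) *\<^sub>R a \<in> ?V'"
        using V aa by (simp add: subspace_diff subspace_scale inner_diff_left)
      then have "v - (v \<bullet> a) *\<^sub>R a \<in> span (b ` {..<dim ?V'})"
        using b by (simp add: is_ortho_basis_def)
      then show "v \<in> span (insert a (b ` {..<dim ?V'}))"
        using span_breakdown_eq by blast
    qed
  qed
  moreover
  have ba: "b j \<bullet> a = 0" "a \<bullet> b j = 0" if "j < dim ?V'" for j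
    using bV[OF that] by (simp_all add: inner_commute)
  have bb: "b j \<bullet> b k = (if j = k then 1 else 0)" if "j < dim ?V'" "k < dim ?V'" for j k
    using b that unfolding is_ortho_basis_def by blast
  have "case_nat a b j \<bullet> case_nat a b k = (if j = k then 1 else 0)"
    if "j < dim V" "k < dim V" for j k
    using that aa ba bb unfolding d by (cases j; cases k) simp_all
  ultimately show ?thesis
    unfolding is_ortho_basis_def img by blast
qed

text \<open>
  A singular value decomposition: a pair of unit vectors with maximal inner product supplies the first
  basis vectors and the smallest angle. Each of them is orthogonal to the complement of the other in
  its own subspace, so the induction hypothesis for the two complements yields the remaining vectors.
\<close>

lemma principal_angles_exist:
  fixes V W :: "'a::euclidean_space set"
  assumes "subspace V" "subspace W" "dim V = dim W"
  shows "\<exists>\<theta>. is_principal_angles V W \<theta>"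
  using assms
proof (induction "dim V" arbitrary: V W)
  case 0
  then have "dim V = 0" "dim W = 0" by simp_all
  moreover from this have "V = {0}" "W = {0}"
    using 0 subspace_0 dim_eq_0 by blast+
  ultimately have "is_ortho_basis V (\<lambda>_. 0)" "is_ortho_basis W (\<lambda>_. 0)"
    by (simp_all add: is_ortho_basis_def)
  then have "is_principal_angles V W []"
    unfolding is_principal_angles_def \<open>dim V = 0\<close> by auto
  then show ?case ..
next
  case (Suc d)
  obtain a b where ab: "a \<in> V" "b \<in> W" "norm a = 1" "norm b = 1" "0 \<le> a \<bullet> b"
    and max: "\<And>v w. v \<in> V \<Longrightarrow> w \<in> W \<Longrightarrow> v \<bullet> w \<le> (a \<bullet> b) * norm v * norm w"
    using maximal_inner_pair[of V W] Suc.prems Suc.hyps(2) by (metis Zero_not_Suc)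
  define V' where "V' = {v \<in> V. v \<bullet> a = 0}"
  define W' where "W' = {w \<in> W. w \<bullet> b = 0}"
  have Vb: "v \<bullet> b = 0" if "v \<in> V'" for v
    by (rule maximal_inner_orthogonal[of V a])
       (use Suc.prems ab max[OF _ ab(2)] that in \<open>auto simp: V'_def\<close>)
  have Wa: "w \<bullet> a = 0" if "w \<in> W'" for w
    by (rule maximal_inner_orthogonal[of W b])
       (use Suc.prems ab max[OF ab(1)] that in \<open>auto simp: W'_def inner_commute\<close>)
  have dims: "dim V = Suc (dim V')" "dim W = Suc (dim W')"
    using dim_orthogonal_complement_of_unit[of V a] dim_orthogonal_complement_of_unit[of W b]
      Suc.prems ab unfolding V'_def W'_def by force+
  have sub: "subspace V'" "subspace W'"
    using Suc.prems unfolding V'_def W'_def subspace_def by (auto simp: inner_add_left)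
  have "\<exists>\<theta>. is_principal_angles V' W' \<theta>"
    using Suc.hyps Suc.prems dims sub by auto
  then obtain \<theta> a' b' where \<theta>: "length \<theta> = dim V'" "sorted \<theta>" "set \<theta> \<subseteq> {0..pi/2}"
    and a': "is_ortho_basis V' a'" and b': "is_ortho_basis W' b'"
    and cos: "\<And>j k. j < dim V' \<Longrightarrow> k < dim V' \<Longrightarrow> a' j \<bullet> b' k = (if j = k then cos (\<theta> ! j) else 0)"
    unfolding is_principal_angles_def by blast
  have a'V: "a' j \<in> V'" "norm (a' j) = 1" if "j < dim V'" for j
    using is_ortho_basis_in[OF a' that] is_ortho_basis_norm[OF a' that] by simp_all
  have b'W: "b' j \<in> W'" "norm (b' j) = 1" if "j < dim V'" for j
  proof -
    have "j < dim W'"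
      using that dims Suc.prems by simp
    then show "b' j \<in> W'" "norm (b' j) = 1"
      using is_ortho_basis_in[OF b'] is_ortho_basis_norm[OF b'] by simp_all
  qed
  define t where "t = arccos (a \<bullet> b)"
  have ab1: "a \<bullet> b \<le> 1"
    using norm_cauchy_schwarz[of a b] ab by simp
  have t: "cos t = a \<bullet> b" "0 \<le> t" "t \<le> pi / 2"
    unfolding t_def using ab1 ab(5) by (auto intro!: cos_arccos arccos_lbound arccos_le_pi2 simp del: le_divide_eq_numeral1)
  have "t \<le> \<theta> ! j" if "j < dim V'" for j
  proof (rule ccontr)
    assume "\<not> t \<le> \<theta> ! j"
    moreover have "\<theta> ! j \<in> set \<theta>"
      using \<theta>(1) that by simp
    then have "0 \<le> \<theta> ! j"
      using \<theta>(3) by auto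
    ultimately have "cos t < cos (\<theta> ! j)"
      using t by (intro cos_monotone_0_pi) auto
    moreover have "cos (\<theta> ! j) \<le> cos t"
      using max[of "a' j" "b' j"] cos[OF that that] a'V[OF that] b'W[OF that] t
      by (simp add: V'_def W'_def)
    ultimately show False by simp
  qed
  then have "sorted (t # \<theta>)"
    using \<theta> by (auto simp: in_set_conv_nth)
  moreover have "is_ortho_basis V (case_nat a a')" "is_ortho_basis W (case_nat b b')"
    using is_ortho_basis_Cons Suc.prems ab a' b' unfolding V'_def W'_def by blast+
  moreover have "case_nat a a' j \<bullet> case_nat b b' k = (if j = k then cos ((t # \<theta>) ! j) else 0)"
    if "j < dim V" "k < dim V" for j k
    using that cos Vb Wa a'V(1) b'W(1) t(1) unfolding dims
    by (cases j; cases k) (simp_all add: inner_commute[of a])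
  moreover have "length (t # \<theta>) = dim V" "set (t # \<theta>) \<subseteq> {0..pi / 2}"
    using \<theta> t dims by simp_all
  ultimately have "is_principal_angles V W (t # \<theta>)"
    unfolding is_principal_angles_def by blast
  then show ?case ..
qed

section \<open>Multiplicities of the squares of a skew-symmetric matrix\<close>

lemma det_ring_hom:
  fixes h :: "'a::comm_ring_1 \<Rightarrow> 'b::comm_ring_1" and A :: "'a^'n::finite^'n"
  assumes one: "h 1 = 1" and add: "\<And>x y. h (x + y) = h x + h y"
    and mult: "\<And>x y. h (x * y) = h x * h y"
  shows "det (\<chi> i j. h (A $ i $ j)) = h (det A)"
proof -
  have zero: "h 0 = 0"
    using add[of 0 0] by simp
  have minus: "h (- x) = - h x" for x
    using add[of x "- x"] zero by (simp add: eq_neg_iff_add_eq_0 add.commute)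
  have sgn: "h (of_int (sign p)) = of_int (sign p)" for p :: "'n \<Rightarrow> 'n"
    by (simp add: sign_def one minus)
  have hsum: "h (sum f X) = (\<Sum>x\<in>X. h (f x))" for f :: "('n \<Rightarrow> 'n) \<Rightarrow> 'a" and X
    by (induction X rule: infinite_finite_induct) (simp_all add: zero add)
  have hprod: "h (prod f X) = (\<Prod>x\<in>X. h (f x))" for f :: "'n \<Rightarrow> 'a" and X
    by (induction X rule: infinite_finite_induct) (simp_all add: one mult)
  show ?thesis
    by (simp add: det_def hsum hprod mult sgn)
qed

lemma order_prod_nonzero:
  fixes p :: "'i \<Rightarrow> 'a::idom poly"
  assumes "finite A" "\<And>i. i \<in> A \<Longrightarrow> p i \<noteq> 0"
  shows "order z (\<Prod>i\<in>A. p i) = (\<Sum>i\<in>A. order z (p i))"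
  using assms
proof (induction A rule: finite_induct)
  case (insert i A)
  then have "p i * (\<Prod>i\<in>A. p i) \<noteq> 0"
    by simp
  with insert show ?case
    by (simp add: order_mult)
qed simp

text \<open>
  \<open>X\<^sup>2 - z\<^sup>2 = (X - z) (X + z)\<close> has a simple root at \<open>z\<close> because \<open>z \<noteq> - z\<close>.
\<close>

lemma order_square_plus_const:
  fixes z d :: complex
  assumes "z \<noteq> 0"
  shows "order z [:d, 0, 1:] = (if d = - z\<^sup>2 then 1 else 0)"
proof (cases "d = - z\<^sup>2")
  case True
  have "[:d, 0, 1:] = [:- z, 1:] * [:z, 1:]"
    by (simp add: True power2_eq_square)
  moreover have "order z [:- z, 1:] = 1"
    using order_power_n_n[of z 1] by simp
  moreover have "order z [:z, 1:] = 0"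
    using assms by (intro order_0I) simp
  ultimately show ?thesis
    using True by (simp add: order_mult del: mult_pCons_left mult_pCons_right)
next
  case False
  then have "poly [:d, 0, 1:] z \<noteq> 0"
    by (simp add: power2_eq_square add_eq_0_iff2)
  then show ?thesis
    using False by (simp add: order_0I)
qed

text \<open>
  This is what makes the principal angles of \<open>V\<close> and \<open>\<i>V\<close> other than \<open>\<pi>/2\<close> come in equal pairs. With
  \<open>P = X I + B\<close>, skew symmetry gives \<open>P\<^sup>T = X I - B\<close>, hence \<open>P P\<^sup>T = X\<^sup>2 I + B B\<^sup>T\<close>, so \<open>(det P)\<^sup>2\<close> is the
  product of the \<open>X\<^sup>2 + d j\<close>. At a square root \<open>z\<close> of \<open>- w\<close> the product vanishes to the order of the
  multiplicity of \<open>w\<close>, and a square vanishes to even order.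
\<close>

lemma skew_symmetric_even_multiplicity:
  fixes B :: "complex^'n::finite^'n" and d :: "'n \<Rightarrow> complex"
  assumes skew: "\<And>j k. B $ k $ j = - B $ j $ k"
    and diag: "\<And>j k. (\<Sum>l\<in>UNIV. B $ j $ l * B $ k $ l) = (if j = k then d j else 0)"
    and "w \<noteq> 0"
  shows "even (card {j. d j = w})"
proof -
  define z where "z = csqrt (- w)"
  have z: "z \<noteq> 0" "- z\<^sup>2 = w"
    using \<open>w \<noteq> 0\<close> by (simp_all add: z_def)
  define X :: "complex poly" where "X = [:0, 1:]"
  define P :: "complex poly^'n^'n" where "P = (\<chi> j k. (if j = k then X else 0) + [:B $ j $ k:])"
  have "(P ** transpose P) $ j $ k = (if j = k then [:d j, 0, 1:] else 0)" for j k
  proof -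
    have "(P ** transpose P) $ j $ k
        = (\<Sum>l\<in>UNIV. (if j = l then if k = l then X * X else 0 else 0)
              + (if j = l then X * [:B $ k $ l:] else 0)
              + (if k = l then X * [:B $ j $ l:] else 0) + [:B $ j $ l * B $ k $ l:])"
      unfolding matrix_matrix_mult_def transpose_def P_def
      by (simp, rule sum.cong) (auto simp: algebra_simps)
    also have "\<dots> = (if j = k then X * X else 0) + X * [:B $ k $ j:] + X * [:B $ j $ k:]
        + [:\<Sum>l\<in>UNIV. B $ j $ l * B $ k $ l:]"
      by (simp add: sum.distrib sum_to_poly)
    also have "\<dots> = (if j = k then [:d j, 0, 1:] else 0)"
      unfolding diag skew[of j k] by (simp add: X_def)
    finally show ?thesis .
  qed
  then have "det (P ** transpose P) = (\<Prod>j\<in>UNIV. [:d j, 0, 1:])"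
    by (subst det_diagonal) simp_all
  then have "det P * det P = (\<Prod>j\<in>UNIV. [:d j, 0, 1:])"
    by (simp add: det_mul)
  moreover have "(\<Prod>j\<in>UNIV. [:d j, 0, 1:]) \<noteq> 0"
    by simp
  ultimately have "2 * order z (det P) = order z (\<Prod>j\<in>UNIV. [:d j, 0, 1:])"
    by (metis mult_2 order_mult)
  also have "\<dots> = (\<Sum>j\<in>UNIV. if d j = w then 1 else 0)"
    by (subst order_prod_nonzero) (simp_all add: order_square_plus_const z)
  also have "\<dots> = card {j. d j = w}"
    by (simp add: sum.If_cases)
  finally show ?thesis
    by (metis dvd_triv_left)
qed

text \<open>
  In a sorted list the occurrences of each value are consecutive. If all values other than \<open>m\<close>
  have even multiplicity, the entries at positions \<open>2 j\<close> and \<open>2 j + 1\<close> agree; an entry left over at the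
  end equals \<open>m\<close> and contributes the factor 1.
\<close>

lemma prod_even_positions_squared:
  fixes g :: "'a::linorder \<Rightarrow> 'b::comm_monoid_mult"
  assumes "sorted xs" "\<And>x. x \<in> set xs \<Longrightarrow> x \<le> m" "g m = 1"
    and "\<And>x. x \<noteq> m \<Longrightarrow> even (count_list xs x)"
  shows "(\<Prod>j<(length xs + 1) div 2. g (xs ! (2 * j)))\<^sup>2 = (\<Prod>j<length xs. g (xs ! j))"
  using assms
proof (induction xs rule: induct_list012)
  case (2 x)
  have "x = m"
    using 2(4)[of x] by auto
  then show ?case
    using 2 by simp
next
  case (3 x y zs)
  have "y = x"
  proof (cases "x = m")
    case True
    then show ?thesis
      using 3(3) 3(4)[of y] by simp
  next
    case False
    have "count_list (y # zs) x \<noteq> 0"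
    proof
      assume "count_list (y # zs) x = 0"
      with 3(6)[OF False] show False
        by simp
    qed
    then have "x \<in> set (y # zs)"
      by (meson count_list_0_iff)
    then show ?thesis
      using 3(3) by auto
  qed
  have "even (count_list zs u)" if "u \<noteq> m" for u
    using 3(6)[OF that] \<open>y = x\<close> by (simp split: if_splits)
  then have "(\<Prod>j<(length zs + 1) div 2. g (zs ! (2 * j)))\<^sup>2 = (\<Prod>j<length zs. g (zs ! j))"
    using 3 by (intro 3(1)) auto
  moreover have "(length (x # y # zs) + 1) div 2 = Suc ((length zs + 1) div 2)"
    by simp
  ultimately show ?case
    using \<open>y = x\<close>
    by (simp add: prod.lessThan_Suc_shift power_mult_distrib power2_eq_square mult_ac
             del: prod.lessThan_Suc)
qed simp

section \<open>Frames of real subspaces of complex space\<close>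

text \<open>
  When \<open>f\<close> is an isometry onto a real subspace \<open>V\<close>, the columns are a real orthonormal basis of \<open>V\<close>,
  read as vectors of \<open>\<complex>\<^sup>n\<close>.
\<close>

definition frame_matrix :: "(real^'n::finite \<Rightarrow> complex^'n) \<Rightarrow> complex^'n^'n" where
  "frame_matrix f = (\<chi> i j. f (axis j 1) $ i)"

lemma linear_expand_axis:
  fixes f :: "real^'n::finite \<Rightarrow> 'b::real_vector"
  assumes "linear f"
  shows "f x = (\<Sum>k\<in>UNIV. x $ k *\<^sub>R f (axis k 1))"
proof -
  have "f x = f (\<Sum>k\<in>UNIV. x $ k *\<^sub>R axis k 1)"
    using basis_expansion[of x] by (simp add: scalar_mult_eq_scaleR)
  then show ?thesis
    using assms by (simp add: linear_sum linear_scale)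
qed

lemma det_frame_matrix_compose:
  assumes "linear f"
  shows "det (frame_matrix (f \<circ> L)) = det (frame_matrix f) * of_real (det (matrix L))"
proof -
  have "frame_matrix (f \<circ> L) = frame_matrix f ** (\<chi> i j. of_real (matrix L $ i $ j))"
    by (simp add: vec_eq_iff frame_matrix_def matrix_matrix_mult_def matrix_def
        linear_expand_axis[OF assms, of "L _"] scaleR_conv_of_real[where 'a = complex] mult.commute)
  then show ?thesis
    using det_ring_hom[of "of_real :: real \<Rightarrow> complex" "matrix L"] by (simp add: det_mul)
qed

lemma det_frame_matrix_complex_linear:
  assumes "Vector_Spaces.linear (*s) (*s) T"
  shows "det (frame_matrix (T \<circ> f)) = det (matrix T) * det (frame_matrix f)"
proof -
  have "T (f x) $ i = (\<Sum>k\<in>UNIV. matrix T $ i $ k * f x $ k)" for x i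
    unfolding matrix_works[OF assms, of "f x", symmetric] by (simp add: matrix_vector_mult_def)
  then have "frame_matrix (T \<circ> f) = matrix T ** frame_matrix f"
    by (simp add: vec_eq_iff frame_matrix_def matrix_matrix_mult_def)
  then show ?thesis
    by (simp add: det_mul)
qed

lemma linear_factor_through_injection:
  fixes f :: "'a::real_vector \<Rightarrow> 'c::real_vector" and g :: "'b::real_vector \<Rightarrow> 'c"
  assumes "linear f" "linear g" "inj g" "range f \<subseteq> range g"
  obtains L where "linear L" "f = g \<circ> L"
proof -
  obtain g' where g': "linear g'" "g' \<circ> g = id"
    using linear_injective_left_inverse[OF assms(2,3)] by blast
  have "g (g' (f x)) = f x" for x
  proof -
    obtain y where "f x = g y"
      using assms(4) by blast
    then show ?thesis
      using g'(2) by (simp add: fun_eq_iff)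
  qed
  then have "f = g \<circ> (g' \<circ> f)"
    by (simp add: fun_eq_iff)
  then show ?thesis
    using that linear_compose[OF assms(1) g'(1)] by blast
qed

lemma linear_isometry_inj:
  assumes "linear f" "\<And>x. norm (f x) = norm x"
  shows "inj f"
  using assms(2) linear_injective_0[OF assms(1)] by (metis norm_eq_zero)

lemma isometries_same_range:
  fixes f g :: "real^'n::finite \<Rightarrow> 'b::real_normed_vector"
  assumes "linear f" "\<And>x. norm (f x) = norm x" "linear g" "\<And>x. norm (g x) = norm x"
    and "range f = range g"
  obtains L where "orthogonal_transformation L" "f = g \<circ> L"
proof -
  obtain L where L: "linear L" "f = g \<circ> L"
    using linear_factor_through_injection[of f g] linear_isometry_inj[of g] assms
    by (metis subset_refl)
  then have "norm (L x) = norm x" for x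
    using assms(2)[of x] assms(4)[of "L x"] by simp
  then have "orthogonal_transformation L"
    using L(1) by (simp add: orthogonal_transformation)
  then show ?thesis
    using that L(2) by blast
qed

text \<open>
  Two orthonormal bases of the same real subspace differ by a real orthogonal matrix.
\<close>

lemma cmod_det_frame_matrix_unique:
  assumes "linear f" "\<And>x. norm (f x) = norm x" "linear g" "\<And>x. norm (g x) = norm x"
    and "range f = range g"
  shows "cmod (det (frame_matrix f)) = cmod (det (frame_matrix g))"
proof -
  obtain L where "orthogonal_transformation L" "f = g \<circ> L"
    using isometries_same_range[of f g] assms by blast
  then show ?thesis
    using det_frame_matrix_compose[OF assms(3), of L] by (simp add: norm_mult)
qed

lemma isometry_of_ortho_basis:
  fixes V :: "'a::euclidean_space set" and e :: "'n::finite \<Rightarrow> nat"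
  assumes a: "is_ortho_basis V a" and V: "subspace V" "dim V = CARD('n)"
    and e: "bij_betw e UNIV {..<CARD('n)}"
  obtains f :: "real^'n \<Rightarrow> 'a" where "linear f" "\<And>x. norm (f x) = norm x" "range f = V"
    "\<And>j. f (axis j 1) = a (e j)"
proof -
  define f where "f x = (\<Sum>j\<in>UNIV. x $ j *\<^sub>R a (e j))" for x :: "real^'n"
  have e_less: "e j < dim V" for j
    using e V(2) bij_betwE by fastforce
  have e_eq: "e j = e k \<longleftrightarrow> j = k" for j k
    using e by (metis UNIV_I bij_betw_inv_into_left)
  have aa: "a (e j) \<bullet> a (e k) = (if j = k then 1 else 0)" for j k
    using a e_less e_eq unfolding is_ortho_basis_def by simp
  have lin: "linear f"
    unfolding f_def by (rule linearI) (simp_all add: algebra_simps sum.distrib scaleR_sum_right)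
  have axis: "f (axis j 1) = a (e j)" for j
    by (simp add: f_def axis_def if_distrib[of "\<lambda>c. c *\<^sub>R _"] cong: if_cong)
  have "f x \<bullet> f x = x \<bullet> x" for x
    by (simp add: f_def inner_sum_left inner_sum_right aa inner_vec_def if_distrib[of "\<lambda>c. _ * c"]
        cong: if_cong)
  then have iso: "norm (f x) = norm x" for x
    by (simp add: norm_eq_sqrt_inner)
  have "range f = V"
  proof
    show "range f \<subseteq> V"
      using is_ortho_basis_in[OF a e_less] V(1)
      by (auto simp: f_def intro!: subspace_sum subspace_scale)
    have "a ` {..<dim V} \<subseteq> range f"
    proof
      fix y assume "y \<in> a ` {..<dim V}"
      then obtain j where "y = a (e j)"
        using e V(2) by (metis bij_betw_imp_surj_on imageE)
      then show "y \<in> range f"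
        using axis by (metis rangeI)
    qed
    then have "span (a ` {..<dim V}) \<subseteq> range f"
      by (rule span_minimal) (simp add: lin linear_subspace_image subspace_UNIV)
    then show "V \<subseteq> range f"
      using a unfolding is_ortho_basis_def by simp
  qed
  with lin iso axis show ?thesis
    using that by blast
qed

lemma linear_i_times: "linear (\<lambda>v::complex^'n. \<i> *s v)"
  by (rule linearI) (simp_all add: vec_eq_iff algebra_simps)

lemma norm_i_times: "norm (\<i> *s v) = norm (v :: complex^'n::finite)"
  by (simp add: norm_vec_def norm_mult)

lemma inner_i_times_skew:
  fixes x y :: "complex^'n::finite"
  shows "y \<bullet> (\<i> *s x) = - (x \<bullet> (\<i> *s y))"
  by (simp add: inner_vec_def inner_complex_def algebra_simps flip: sum_negf)

lemma hermitian_product_eq: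
  fixes x y :: "complex^'n::finite"
  shows "(\<Sum>i\<in>UNIV. cnj (x $ i) * y $ i) = Complex (x \<bullet> y) (- (x \<bullet> (\<i> *s y)))"
  by (simp add: complex_eq_iff inner_vec_def inner_complex_def algebra_simps flip: sum_negf)

text \<open>
  Let \<open>M\<close> be the frame matrix. Its columns are orthonormal over \<open>\<real>\<close>, so the Hermitian Gram matrix
  \<open>M\<^sup>* M\<close> equals \<open>I - \<i> B\<close> where the real matrix \<open>B\<close> holds the inner products with the \<open>\<i>\<close>-multiples of
  the columns. Multiplied by its conjugate it gives \<open>(I - \<i> B) (I + \<i> B) = I + B\<^sup>2 = I - B B\<^sup>T\<close>, as \<open>B\<close>
  is skew, while both Gram matrices have determinant \<open>\<bar>det M\<bar>\<^sup>2\<close>.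
\<close>

lemma cmod_det_frame_matrix_power4:
  fixes f :: "real^'n::finite \<Rightarrow> complex^'n" and d :: "'n \<Rightarrow> real"
  assumes f: "linear f" "\<And>x. norm (f x) = norm x"
    and diag: "\<And>j k. (\<Sum>l\<in>UNIV. (f (axis j 1) \<bullet> (\<i> *s f (axis l 1))) * (f (axis k 1) \<bullet> (\<i> *s f (axis l 1))))
                 = (if j = k then d j else 0)"
  shows "cmod (det (frame_matrix f)) ^ 4 = (\<Prod>j\<in>UNIV. 1 - d j)"
proof -
  define M where "M = frame_matrix f"
  define M' where "M' = (\<chi> i j. cnj (M $ i $ j))"
  define B where "B j k = f (axis j 1) \<bullet> (\<i> *s f (axis k 1))" for j k
  have skew: "B k j = - B j k" for j k
    unfolding B_def by (rule inner_i_times_skew)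
  have M: "M $ i $ j = f (axis j 1) $ i" for i j
    by (simp add: M_def frame_matrix_def)
  have on: "f (axis j 1) \<bullet> f (axis k 1) = (if j = k then 1 else 0)" for j k
    using norm_preserving_inner[OF f] by (simp add: inner_axis_axis)
  have G: "(transpose M' ** M) $ j $ k = (if j = k then 1 else 0) - \<i> * of_real (B j k)" for j k
    using hermitian_product_eq[of "f (axis j 1)" "f (axis k 1)"]
    by (simp add: matrix_matrix_mult_def transpose_def M'_def M on B_def complex_eq_iff)
  have G': "(transpose M ** M') $ j $ k = (if j = k then 1 else 0) + \<i> * of_real (B j k)" for j k
  proof -
    have "(transpose M ** M') $ j $ k = cnj ((transpose M' ** M) $ j $ k)"
      by (simp add: matrix_matrix_mult_def transpose_def M'_def)
    then show ?thesis
      by (simp add: G)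
  qed
  have "((transpose M' ** M) ** (transpose M ** M')) $ j $ k = (if j = k then of_real (1 - d j) else 0)" for j k
  proof -
    have "((transpose M' ** M) ** (transpose M ** M')) $ j $ k
        = (\<Sum>l\<in>UNIV. ((if j = l then 1 else 0) - \<i> * of_real (B j l)) * ((if l = k then 1 else 0) + \<i> * of_real (B l k)))"
      by (subst matrix_matrix_mult_def) (simp add: G G')
    also have "\<dots> = (\<Sum>l\<in>UNIV. (if j = l then (if l = k then 1 else 0) else 0)
          + (if j = l then \<i> * of_real (B l k) else 0) - (if l = k then \<i> * of_real (B j l) else 0)
          + of_real (B j l * B l k))"
      by (rule sum.cong) (auto simp: algebra_simps)
    also have "\<dots> = (if j = k then 1 else 0) + of_real (\<Sum>l\<in>UNIV. B j l * B l k)"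
      by (simp add: sum.distrib sum_subtractf)
    also have "(\<Sum>l\<in>UNIV. B j l * B l k) = - (\<Sum>l\<in>UNIV. B j l * B k l)"
      by (simp add: skew[of k] flip: sum_negf)
    also have "(if j = k then 1 else 0) + complex_of_real (- (\<Sum>l\<in>UNIV. B j l * B k l))
        = (if j = k then of_real (1 - d j) else 0)"
      using diag[of j k] by (simp add: B_def)
    finally show ?thesis .
  qed
  then have "det ((transpose M' ** M) ** (transpose M ** M')) = (\<Prod>j\<in>UNIV. of_real (1 - d j))"
    by (subst det_diagonal) simp_all
  moreover have "det M' = cnj (det M)"
    unfolding M'_def by (rule det_ring_hom) simp_all
  ultimately have "(det M * cnj (det M))\<^sup>2 = of_real (\<Prod>j\<in>UNIV. 1 - d j)"
    by (simp add: det_mul power2_eq_square mult_ac)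
  then have "complex_of_real (cmod (det M) ^ 4) = of_real (\<Prod>j\<in>UNIV. 1 - d j)"
    by (simp add: complex_norm_square[symmetric] flip: power_mult)
  then show ?thesis
    unfolding M_def of_real_eq_iff .
qed

section \<open>The holomorphy index as a determinant\<close>

lemma i_times_subspace:
  fixes V :: "(complex^'n::finite) set"
  assumes "subspace V"
  shows "subspace (i_times V)" "dim (i_times V) = dim V"
proof -
  show "subspace (i_times V)"
    unfolding i_times_def by (rule linear_subspace_image[OF linear_i_times assms])
  have "inj_on (\<lambda>v::complex^'n. \<i> *s v) (span V)"
    using linear_isometry_inj[OF linear_i_times norm_i_times] inj_on_subset by blast
  then show "dim (i_times V) = dim V"
    unfolding i_times_def by (rule dim_image_eq[OF linear_i_times])
qed

lemma principal_angles_i_times: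
  assumes "subspace V"
  shows "is_principal_angles V (i_times V) (principal_angles V (i_times V))"
  unfolding principal_angles_def
  using principal_angles_exist[of V "i_times V"] i_times_subspace[OF assms] assms
  by (metis someI_ex)

text \<open>
  Principal angles diagonalize \<open>B B\<^sup>T\<close>, where \<open>B\<close> pairs an orthonormal basis of \<open>V\<close> with its own
  \<open>\<i>\<close>-multiples. The principal basis of \<open>\<i>V\<close> may be a different one, but it arises from these multiples
  by an orthogonal matrix \<open>Q\<close>. Then \<open>B Q\<close> is the diagonal matrix of the cosines, and \<open>Q\<close> cancels in
  \<open>B B\<^sup>T = (B Q) (B Q)\<^sup>T\<close>. The bijection \<open>e\<close> only translates between the index type and positions in
  the list of angles.
\<close>

lemma principal_cosines_diagonalize:
  fixes V :: "(complex^'n::finite) set" and e :: "'n \<Rightarrow> nat"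
  assumes V: "subspace V" "dim V = CARD('n)" and e: "bij_betw e UNIV {..<CARD('n)}"
    and \<theta>: "is_principal_angles V (i_times V) \<theta>"
  obtains f :: "real^'n \<Rightarrow> complex^'n" where "linear f" "\<And>x. norm (f x) = norm x" "range f = V"
    "\<And>j k. (\<Sum>l\<in>UNIV. (f (axis j 1) \<bullet> (\<i> *s f (axis l 1))) * (f (axis k 1) \<bullet> (\<i> *s f (axis l 1))))
       = (if j = k then (cos (\<theta> ! e j))\<^sup>2 else 0)"
proof -
  obtain a b where a: "is_ortho_basis V a" and b: "is_ortho_basis (i_times V) b"
    and cos: "\<And>j k. j < dim V \<Longrightarrow> k < dim V \<Longrightarrow> a j \<bullet> b k = (if j = k then cos (\<theta> ! j) else 0)"
    using \<theta> unfolding is_principal_angles_def by blast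
  obtain f :: "real^'n \<Rightarrow> complex^'n" where f: "linear f" "\<And>x. norm (f x) = norm x" "range f = V"
    "\<And>j. f (axis j 1) = a (e j)"
    using isometry_of_ortho_basis[OF a V e] by blast
  have iV: "subspace (i_times V)" "dim (i_times V) = CARD('n)"
    using i_times_subspace[OF V(1)] V(2) by simp_all
  obtain g :: "real^'n \<Rightarrow> complex^'n" where g: "linear g" "\<And>x. norm (g x) = norm x" "range g = i_times V"
    "\<And>j. g (axis j 1) = b (e j)"
    using isometry_of_ortho_basis[OF b iV e] by blast
  let ?h = "(\<lambda>v. \<i> *s v) \<circ> f"
  have h: "linear ?h"
    by (rule linear_compose[OF f(1) linear_i_times])
  have "range g = range ?h"
    unfolding g(3) i_times_def f(3)[symmetric] by (simp add: image_image)
  then obtain Q where Q: "orthogonal_transformation Q" "g = ?h \<circ> Q"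
    using isometries_same_range[OF g(1,2) h] f(2) norm_i_times by (metis comp_apply)
  define B :: "real^'n^'n" where "B = (\<chi> j k. f (axis j 1) \<bullet> (\<i> *s f (axis k 1)))"
  have e_less: "e j < dim V" for j
    using e V(2) bij_betwE by fastforce
  have e_eq: "e j = e k \<longleftrightarrow> j = k" for j k
    using e by (metis UNIV_I bij_betw_inv_into_left)
  have BQ: "(B ** matrix Q) $ j $ k = (if j = k then cos (\<theta> ! e j) else 0)" for j k
  proof -
    have "f (axis j 1) \<bullet> g (axis k 1) = f (axis j 1) \<bullet> ?h (Q (axis k 1))"
      using Q(2) by simp
    also have "\<dots> = (\<Sum>l\<in>UNIV. B $ j $ l * matrix Q $ l $ k)"
      unfolding linear_expand_axis[OF h, of "Q (axis k 1)"]
      by (simp add: inner_sum_right B_def matrix_def mult.commute)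
    finally show ?thesis
      using cos[OF e_less e_less, of j k] by (simp add: matrix_matrix_mult_def f(4) g(4) e_eq)
  qed
  have "orthogonal_matrix (matrix Q)"
    using Q(1) orthogonal_transformation_matrix by blast
  then have QQ: "matrix Q ** transpose (matrix Q) = mat 1"
    unfolding orthogonal_matrix_def by blast
  have "(B ** matrix Q) ** transpose (B ** matrix Q)
      = B ** (matrix Q ** transpose (matrix Q)) ** transpose B"
    unfolding matrix_transpose_mul matrix_mul_assoc ..
  then have BB: "B ** transpose B = (B ** matrix Q) ** transpose (B ** matrix Q)"
    by (simp only: QQ matrix_mul_rid)
  have "(\<Sum>l\<in>UNIV. B $ j $ l * B $ k $ l) = (if j = k then (cos (\<theta> ! e j))\<^sup>2 else 0)" for j k
  proof -
    have "(\<Sum>l\<in>UNIV. B $ j $ l * B $ k $ l) = (B ** transpose B) $ j $ k"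
      by (simp add: matrix_matrix_mult_def transpose_def)
    also have "\<dots> = (\<Sum>l\<in>UNIV. (B ** matrix Q) $ j $ l * (B ** matrix Q) $ k $ l)"
      unfolding BB by (subst matrix_matrix_mult_def) (simp add: transpose_def)
    also have "\<dots> = (\<Sum>l\<in>UNIV. if j = l then if k = l then (cos (\<theta> ! e j))\<^sup>2 else 0 else 0)"
      unfolding BQ by (rule sum.cong) (auto simp: power2_eq_square)
    finally show ?thesis
      by simp
  qed
  then show ?thesis
    using that[OF f(1,2,3)] by (simp add: B_def)
qed

text \<open>
  In a principal basis \<open>B B\<^sup>T\<close> is diagonal with entries \<open>cos\<^sup>2 \<theta>\<^sub>j\<close>, so \<open>\<bar>det M\<bar>\<^sup>4\<close> is the product of all
  \<open>sin\<^sup>2 \<theta>\<^sub>j\<close>. As the angles below \<open>\<pi>/2\<close> occur in equal pairs, the product of all \<open>sin \<theta>\<^sub>j\<close> is the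
  square of the product over every second angle, which is the holomorphy index.
\<close>

lemma holomorphy_index_eq_det:
  fixes V :: "(complex^'n::finite) set"
  assumes V: "subspace V" "dim V = CARD('n)"
    and f: "linear f" "\<And>x. norm (f x) = norm x" "range f = V"
  shows "holomorphy_index V = cmod (det (frame_matrix f))"
proof -
  define \<theta> where "\<theta> = principal_angles V (i_times V)"
  have \<theta>: "is_principal_angles V (i_times V) \<theta>"
    unfolding \<theta>_def by (rule principal_angles_i_times[OF V(1)])
  then have len: "length \<theta> = CARD('n)" and sorted: "sorted \<theta>" and ran: "set \<theta> \<subseteq> {0..pi / 2}"
    using V(2) unfolding is_principal_angles_def by simp_all
  obtain e :: "'n \<Rightarrow> nat" where e: "bij_betw e UNIV {..<CARD('n)}"
    using ex_bij_betw_finite_nat[of "UNIV :: 'n set"] by (auto simp: atLeast0LessThan)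
  obtain g :: "real^'n \<Rightarrow> complex^'n" where g: "linear g" "\<And>x. norm (g x) = norm x" "range g = V"
    and diag: "\<And>j k. (\<Sum>l\<in>UNIV. (g (axis j 1) \<bullet> (\<i> *s g (axis l 1))) * (g (axis k 1) \<bullet> (\<i> *s g (axis l 1))))
       = (if j = k then (cos (\<theta> ! e j))\<^sup>2 else 0)"
    using principal_cosines_diagonalize[OF V e \<theta>] by blast
  have angle: "0 \<le> \<theta> ! j" "\<theta> ! j \<le> pi / 2" if "j < CARD('n)" for j
  proof -
    have "\<theta> ! j \<in> set \<theta>"
      using that len by simp
    then show "0 \<le> \<theta> ! j" "\<theta> ! j \<le> pi / 2"
      using ran by auto
  qed
  have even: "even (count_list \<theta> x)" if "x \<noteq> pi / 2" for x
  proof (cases "x \<in> set \<theta>")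
    case True
    then have x: "0 \<le> x" "x < pi / 2"
      using ran that by auto
    define B :: "complex^'n^'n" where "B = (\<chi> j k. of_real (g (axis j 1) \<bullet> (\<i> *s g (axis k 1))))"
    have "even (card {j. complex_of_real ((cos (\<theta> ! e j))\<^sup>2) = of_real ((cos x)\<^sup>2)})"
    proof (rule skew_symmetric_even_multiplicity)
      show "B $ k $ j = - B $ j $ k" for j k
        unfolding B_def by (simp add: inner_i_times_skew[of "g (axis k 1)"])
      show "(\<Sum>l\<in>UNIV. B $ j $ l * B $ k $ l)
          = (if j = k then complex_of_real ((cos (\<theta> ! e j))\<^sup>2) else 0)" for j k
        using arg_cong[OF diag[of j k], of complex_of_real] by (simp add: B_def)
      show "complex_of_real ((cos x)\<^sup>2) \<noteq> 0"
        using cos_gt_zero_pi[of x] x by simp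
    qed
    moreover have "complex_of_real ((cos (\<theta> ! e j))\<^sup>2) = of_real ((cos x)\<^sup>2) \<longleftrightarrow> \<theta> ! e j = x" for j
    proof -
      have j: "e j < CARD('n)"
        using e bij_betwE by fastforce
      have "complex_of_real ((cos (\<theta> ! e j))\<^sup>2) = of_real ((cos x)\<^sup>2)
          \<longleftrightarrow> (cos (\<theta> ! e j))\<^sup>2 = (cos x)\<^sup>2"
        by (simp only: of_real_eq_iff)
      also have "\<dots> \<longleftrightarrow> cos (\<theta> ! e j) = cos x"
        using x angle[OF j] by (intro power2_eq_iff_nonneg cos_ge_zero) simp_all
      also have "\<dots> \<longleftrightarrow> \<theta> ! e j = x"
        using x angle[OF j] cos_inj_pi[of "\<theta> ! e j" x] by auto
      finally show ?thesis .
    qed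
    moreover have "card {j. \<theta> ! e j = x} = count_list \<theta> x"
    proof -
      have "bij_betw e {j. \<theta> ! e j = x} {k. k < CARD('n) \<and> \<theta> ! k = x}"
      proof (rule bij_betw_imageI)
        show "inj_on e {j. \<theta> ! e j = x}"
          using e bij_betw_imp_inj_on inj_on_subset by blast
        have "{k. k < CARD('n) \<and> \<theta> ! k = x} = {k \<in> range e. \<theta> ! k = x}"
          using bij_betw_imp_surj_on[OF e] by auto
        then show "e ` {j. \<theta> ! e j = x} = {k. k < CARD('n) \<and> \<theta> ! k = x}"
          by auto
      qed
      then have "card {j. \<theta> ! e j = x} = card {k. k < CARD('n) \<and> \<theta> ! k = x}"
        by (rule bij_betw_same_card)
      then show ?thesis
        by (simp add: count_list_eq_length_filter length_filter_conv_card len eq_commute[of x])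
    qed
    ultimately show ?thesis
      by simp
  qed simp
  have "holomorphy_index V = (\<Prod>j<(length \<theta> + 1) div 2. sin (\<theta> ! (2 * j)))"
    by (simp add: holomorphy_index_def kaehler_angle_def \<theta>_def[symmetric] V(2) len
        prod.atLeast1_atMost_eq)
  moreover have "(\<Prod>j<(length \<theta> + 1) div 2. sin (\<theta> ! (2 * j)))\<^sup>2 = (\<Prod>j<length \<theta>. sin (\<theta> ! j))"
  proof (rule prod_even_positions_squared[where m = "pi / 2", OF sorted _ _ even])
    show "x \<le> pi / 2" if "x \<in> set \<theta>" for x
      using that ran by auto
  qed simp
  ultimately have "(holomorphy_index V)\<^sup>2 = (\<Prod>j<length \<theta>. sin (\<theta> ! j))"
    by (simp only:)
  then have "((holomorphy_index V)\<^sup>2)\<^sup>2 = (\<Prod>j<CARD('n). (sin (\<theta> ! j))\<^sup>2)"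
    by (simp add: len prod_power_distrib)
  also have "\<dots> = (\<Prod>j\<in>UNIV. (sin (\<theta> ! e j))\<^sup>2)"
    by (rule prod.reindex_bij_betw[OF e, symmetric])
  also have "\<dots> = (\<Prod>j\<in>UNIV. 1 - (cos (\<theta> ! e j))\<^sup>2)"
    by (simp add: sin_squared_eq)
  also have "\<dots> = cmod (det (frame_matrix g)) ^ 4"
    by (rule cmod_det_frame_matrix_power4[OF g(1,2) diag, symmetric])
  finally have "holomorphy_index V ^ 4 = cmod (det (frame_matrix g)) ^ 4"
    by (simp flip: power_mult)
  moreover have "0 \<le> holomorphy_index V"
    unfolding \<open>holomorphy_index V = _\<close>
  proof (intro prod_nonneg)
    fix j assume "j \<in> {..<(length \<theta> + 1) div 2}"
    then have "2 * j < CARD('n)"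
      by (simp add: len)
    then show "0 \<le> sin (\<theta> ! (2 * j))"
      using angle[of "2 * j"] by (intro sin_ge_zero) linarith+
  qed
  ultimately have "holomorphy_index V = cmod (det (frame_matrix g))"
    by (simp add: power_eq_iff_eq_base)
  also have "\<dots> = cmod (det (frame_matrix f))"
    using f g by (intro cmod_det_frame_matrix_unique) simp_all
  finally show ?thesis .
qed

section \<open>Change of volume under complex linear maps\<close>

lemma subspace_lebesgue_isometry:
  fixes V :: "(complex^'n::finite) set"
  assumes V: "subspace V" "dim V = CARD('n)"
  obtains f :: "real^'n \<Rightarrow> complex^'n" where "linear f" "\<And>x. norm (f x) = norm x" "range f = V"
    "subspace_lebesgue V = embed_measure lebesgue f"
proof -
  let ?P = "\<lambda>f::real^'n \<Rightarrow> complex^'n. linear f \<and> (\<forall>x. norm (f x) = norm x) \<and> range f = V"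
  have "\<exists>f. ?P f"
    using isometry_subspaces[of "UNIV :: (real^'n) set" V] V by (metis subspace_UNIV dim_UNIV DIM_cart
      DIM_real mult.right_neutral UNIV_I)
  then have "?P (SOME f. ?P f)"
    by (rule someI_ex)
  then show ?thesis
    using that[of "SOME f. ?P f"] unfolding subspace_lebesgue_def by blast
qed

theorem corollary6p2:
  fixes T :: "complex ^ 'n::finite \<Rightarrow> complex ^ 'n"
    and V E :: "(complex ^ 'n) set"
  assumes "Vector_Spaces.linear (*s) (*s) T"
    and "subspace V" and "dim V = CARD('n)"
    and "E \<in> sets (subspace_lebesgue V)"
  shows "ennreal (holomorphy_index (T ` V)) * n_volume (T ` E)
         = ennreal (cmod (det (matrix T))) * ennreal (holomorphy_index V) * n_volume E"
proof -
  have T_eq: "T = (*v) (matrix T)"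
    using matrix_works[OF assms(1)] by auto
  have T: "linear T"
    by (subst T_eq) (rule matrix_vector_mul_linear)
  obtain f :: "real^'n \<Rightarrow> complex^'n" where f: "linear f" "\<And>x. norm (f x) = norm x" "range f = V"
    and fV: "subspace_lebesgue V = embed_measure lebesgue f"
    using subspace_lebesgue_isometry[OF assms(2,3)] by blast
  have inj_f: "inj f"
    by (rule linear_isometry_inj[OF f(1,2)])
  obtain A where A: "A \<in> sets lebesgue" "E = f ` A"
    using assms(4) inj_f unfolding fV by (auto simp: sets_embed_measure)
  have "E \<subseteq> V"
    using A(2) f(3) by auto
  show ?thesis
  proof (cases "dim E < CARD('n)")
    case True
    then have "dim (T ` E) < CARD('n)"
      using dim_image_le[OF T, of E] by simp
    with True show ?thesis
      by (simp add: n_volume_def)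
  next
    case False
    then have "dim E = dim V"
      using dim_subset[OF \<open>E \<subseteq> V\<close>] assms(3) by simp
    then have span_E: "span E = V"
      using dim_eq_span[OF \<open>E \<subseteq> V\<close>] span_eq_iff[of V] assms(2) by simp
    have "n_volume E = emeasure (embed_measure lebesgue f) E"
      using False by (simp only: n_volume_def span_E fV if_False)
    also have "\<dots> = emeasure lebesgue A"
      unfolding A(2) by (rule emeasure_embed_measure_image[OF inj_f A(1)])
    finally have vol_E: "n_volume E = emeasure lebesgue A" .
    show ?thesis
    proof (cases "dim (T ` V) < CARD('n)")
      case True
      then have "dim (T ` E) < CARD('n)"
        using dim_subset[OF image_mono[OF \<open>E \<subseteq> V\<close>], of T] by simp
      moreover have "\<not> inj T"
        using True dim_image_eq[OF T, of V] assms(3) by (metis inj_on_subset less_irrefl top_greatest)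
      then have "\<not> invertible (matrix T)"
        by (metis T_eq inj_matrix_vector_mult)
      then have "det (matrix T) = 0"
        by (simp add: invertible_det_nz)
      ultimately show ?thesis
        by (simp add: n_volume_def)
    next
      case False
      have TV: "subspace (T ` V)" "dim (T ` V) = CARD('n)"
        using linear_subspace_image[OF T assms(2)] dim_image_le[OF T, of V] False assms(3)
        by simp_all
      obtain g :: "real^'n \<Rightarrow> complex^'n" where g: "linear g" "\<And>x. norm (g x) = norm x"
        "range g = T ` V" and gV: "subspace_lebesgue (T ` V) = embed_measure lebesgue g"
        using subspace_lebesgue_isometry[OF TV] by blast
      have inj_g: "inj g"
        by (rule linear_isometry_inj[OF g(1,2)])
      have "range (T \<circ> f) \<subseteq> range g"
        using f(3) g(3) by auto
      then obtain L where L: "linear L" "T \<circ> f = g \<circ> L"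
        using linear_factor_through_injection[OF linear_compose[OF f(1) T] g(1) inj_g] by blast
      \<comment> \<open>\<open>T\<close> maps \<open>V\<close> onto \<open>T V\<close>, and \<open>L\<close> is this map in the coordinates given by \<open>f\<close> and \<open>g\<close>.\<close>
      have "surj L"
      proof -
        have "\<exists>x. L x = y" for y
        proof -
          have "g y \<in> range (T \<circ> f)"
            using f(3) g(3) by (metis image_comp rangeI)
          then show "\<exists>x. L x = y"
            using inj_g unfolding L(2) by (auto dest: injD)
        qed
        then show ?thesis
          by (metis surjI)
      qed
      then have inj_L: "inj L"
        by (rule linear_surjective_imp_injective[OF L(1)]) (rule refl)
      have "T ` E = (T \<circ> f) ` A"
        by (simp add: A(2) image_comp)
      then have TE: "T ` E = g ` L ` A"
        unfolding L(2) by (simp add: image_comp)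
      have span_TE: "span (T ` E) = T ` V"
        by (simp add: linear_span_image[OF T] span_E)
      have "dim (T ` E) = CARD('n)"
        using TV(2) dim_span[of "T ` E"] by (simp add: span_TE)
      then have "n_volume (T ` E) = emeasure (embed_measure lebesgue g) (T ` E)"
        by (simp only: n_volume_def span_TE gV less_irrefl if_False)
      also have "\<dots> = emeasure lebesgue (L ` A)"
        unfolding TE
        by (rule emeasure_embed_measure_image[OF inj_g emeasure_linear_image(1)[OF L(1) inj_L A(1)]])
      also have "\<dots> = ennreal \<bar>det (matrix L)\<bar> * n_volume E"
        using emeasure_linear_image(2)[OF L(1) inj_L A(1)] by (simp add: vol_E)
      finally have vol: "n_volume (T ` E) = ennreal \<bar>det (matrix L)\<bar> * n_volume E" .
      have "det (matrix T) * det (frame_matrix f) = det (frame_matrix g) * of_real (det (matrix L))"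
        using det_frame_matrix_complex_linear[OF assms(1), of f] det_frame_matrix_compose[OF g(1), of L]
        by (simp add: L(2))
      \<comment> \<open>Only \<open>\<bar>det L\<bar>\<close> matters: it is also the factor by which volumes change.\<close>
      from arg_cong[OF this, of cmod]
      have "holomorphy_index (T ` V) * \<bar>det (matrix L)\<bar> = cmod (det (matrix T)) * holomorphy_index V"
        by (simp add: norm_mult holomorphy_index_eq_det[OF TV g] holomorphy_index_eq_det[OF assms(2,3) f])
      then show ?thesis
        unfolding vol by (simp add: mult.assoc[symmetric] ennreal_mult''[symmetric]
            holomorphy_index_eq_det[OF assms(2,3) f])
    qed
  qed
qed

end
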